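(* For each fixed integer $n>1$, let $X_1,\ldots,X_n$ be independent and identically distributed random variables, each with distribution $Exp(1/\log n)$, and let $X_{(n)}=\max\{X_1,\ldots,X_n\}$ be their largest order statistic. Then the mean and variance of $X_{(n)}$ satisfy $$E(X_{(n)})=(\log n)\sum_{j=1}^n\frac{1}{n-j+1}\sim(\log n)(\gamma+\log n)\sim(\log n)^2,$$ $$Var(X_{(n)})=(\log n)^2\sum_{j=1}^n\frac{1}{(n-j+1)^2}\sim(\log n)^2\zeta(2)=(\log n)^2\frac{\pi^2}{6},$$ where the equalities hold for every $n>1$ and the asymptotic relations are as $n\to\infty$. Thus $Var(X_{(n)})/E(X_{(n)})\to\pi^2/6>1$ and $Var(X_{(n)})\sim(\pi^2/6)\,E(X_{(n)})$ as $n\to\infty$; that is, Taylor's law $Var(X_{(n)})\sim c\,(E(X_{(n)}))^b$ holds with $c=\pi^2/6$ and $b=1$.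
   Context: For $\lambda>0$, $Exp(\lambda)$ is the exponential distribution with cumulative distribution function $F(x)=1-\exp(-\lambda x)$ for $x\ge 0$ (so its mean is $1/\lambda$, and $Exp(1/\log n)$ has mean $\log n$). $\gamma\approx 0.5772$ is the Euler–Mascheroni constant and $\zeta$ is the Riemann zeta function. The notation $f\sim g$ means that $f/g\to 1$. The sample, including the common distribution of the $X_i$, changes with $n$. *)

theory Defs
  imports "HOL-Probability.Probability"
begin

definition largest_order_statistic :: "nat \<Rightarrow> (nat \<Rightarrow> 'a \<Rightarrow> real) \<Rightarrow> 'a \<Rightarrow> real" where
  "largest_order_statistic n X \<omega> = Max ((\<lambda>i. X i \<omega>) ` {1..n})"

(* The Riemann zeta function by its Dirichlet series; only meaningful for real s > 1. *)
definition zeta :: "real \<Rightarrow> real" where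
  "zeta s = (\<Sum>k. 1 / real (Suc k) powr s)"

definition taylors_law :: "(nat \<Rightarrow> real) \<Rightarrow> (nat \<Rightarrow> real) \<Rightarrow> real \<Rightarrow> real \<Rightarrow> bool" where
  "taylors_law V E c b \<longleftrightarrow> V \<sim>[sequentially] (\<lambda>n. c * E n powr b)"

end

theory Submission
  imports Defs "HOL-Real_Asymp.Real_Asymp"
begin

text \<open>
  Write \<open>l\<close> for the rate. By independence the maximum \<open>Y\<^sub>n\<close> of \<open>n\<close> exponential variables has
  distribution function \<open>(1 - exp (-l x))^n\<close> on \<open>x \<ge> 0\<close>, hence density
  \<open>f\<^sub>n(x) = n l exp (-l x) (1 - exp (-l x))^(n - 1)\<close> there. The distribution functions for \<open>n + 1\<close>
  and \<open>n\<close> differ by \<open>- exp (-l x) (1 - exp (-l x))^n = - f\<^bsub>n+1\<^esub>(x) / ((n + 1) l)\<close>, so one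
  integration by parts relates the moments \<open>m(n, k) = E(Y\<^sub>n^k)\<close> by
  \<open>m(n + 1, k + 1) = m(n, k + 1) + (k + 1) / ((n + 1) l) * m(n + 1, k)\<close>
  (lemma \<open>max_exponential_density_moment_Suc\<close>). With \<open>f\<^sub>0 = 0\<close> as the start of the induction,
  the cases \<open>k = 0\<close> and \<open>k = 1\<close> give the mean \<open>H\<^sub>n / l\<close> and the second moment
  \<open>(S\<^sub>n + H\<^sub>n^2) / l^2\<close>, where \<open>H\<^sub>n\<close> and \<open>S\<^sub>n\<close> are the sums of \<open>1 / j\<close> and of \<open>1 / j^2\<close>
  for \<open>j = 1, \<dots>, n\<close>; the variance is therefore \<open>S\<^sub>n / l^2\<close>.

  With \<open>l = 1 / ln n\<close>, the asymptotic claims reduce to \<open>H\<^sub>n - ln n \<longlonglongrightarrow> \<gamma>\<close> and to Euler's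
  \<open>S\<^sub>n \<longlonglongrightarrow> \<pi>^2 / 6\<close>: both the mean and \<open>6 / \<pi>^2\<close> times the variance are asymptotically
  equivalent to \<open>(ln n)^2\<close>.
\<close>

section \<open>The density of the maximum of exponential variables\<close>

text \<open>
  The density of the maximum of \<open>n\<close> independent exponential variables of rate \<open>l\<close>. For \<open>n = 0\<close> it is
  identically \<open>0\<close>, which is not a probability density but is the right base case for the
  recurrence between moments below.
\<close>
definition max_exponential_density :: "nat \<Rightarrow> real \<Rightarrow> real \<Rightarrow> real" where
  "max_exponential_density n l x =
    real n * (1 - exp (- l * x)) ^ (n - 1) * exponential_density l x"

lemma max_exponential_density_0 [simp]: "max_exponential_density 0 l x = 0"
  by (simp add: max_exponential_density_def)

lemma max_exponential_density_eq:
  "max_exponential_density n l x =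
    (if x < 0 then 0 else real n * l * exp (- l * x) * (1 - exp (- l * x)) ^ (n - 1))"
  by (simp add: max_exponential_density_def exponential_density_def mult_ac)

lemma max_exponential_density_nonneg:
  "0 < l \<Longrightarrow> 0 \<le> max_exponential_density n l x"
  by (simp add: max_exponential_density_eq)

lemma borel_measurable_max_exponential_density [measurable]:
  "max_exponential_density n l \<in> borel_measurable borel"
  unfolding max_exponential_density_def[abs_def] by measurable

lemma max_exponential_density_le:
  assumes "0 < l"
  shows "max_exponential_density n l x \<le> real n * exponential_density l x"
proof (cases "x < 0")
  case False
  have "(1 - exp (- l * x)) ^ (n - 1) \<le> 1"
    using False assms by (intro power_le_one) auto
  then have "(1 - exp (- l * x)) ^ (n - 1) * (real n * exponential_density l x)
      \<le> 1 * (real n * exponential_density l x)"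
    using exponential_density_nonneg[OF assms, of x] by (intro mult_right_mono) auto
  then show ?thesis by (simp add: max_exponential_density_def mult_ac)
qed (simp add: max_exponential_density_eq exponential_density_def)

lemma integrable_exponential_density_moment:
  assumes "0 < l"
  shows "integrable lborel (\<lambda>x. exponential_density l x * x ^ k)"
proof (rule integrableI_nonneg)
  show "AE x in lborel. 0 \<le> exponential_density l x * x ^ k"
    using assms by (simp add: exponential_density_def)
  show "(\<integral>\<^sup>+ x. ennreal (exponential_density l x * x ^ k) \<partial>lborel) < \<infinity>"
    by (subst nn_integral_erlang_ith_moment[OF assms]) simp
qed measurable

lemma integrable_max_exponential_density_moment:
  assumes "0 < l"
  shows "integrable lborel (\<lambda>x. max_exponential_density n l x * x ^ k)"
proof (rule Bochner_Integration.integrable_bound)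
  show "integrable lborel (\<lambda>x. real n * (exponential_density l x * x ^ k))"
    by (intro integrable_mult_right integrable_exponential_density_moment assms)
  show "AE x in lborel. norm (max_exponential_density n l x * x ^ k)
      \<le> norm (real n * (exponential_density l x * x ^ k))"
  proof (rule AE_I2)
    fix x :: real
    have "norm (max_exponential_density n l x) \<le> norm (real n * exponential_density l x)"
      using max_exponential_density_le[OF assms, of n x] max_exponential_density_nonneg[OF assms, of n x]
      by simp
    then show "norm (max_exponential_density n l x * x ^ k)
        \<le> norm (real n * (exponential_density l x * x ^ k))"
      unfolding mult.assoc[symmetric] norm_mult by (intro mult_right_mono) (auto simp: abs_mult)
  qed
qed measurable

lemma nn_integral_max_exponential_density_atMost:
  assumes "0 < l" "n \<noteq> 0"
  shows "(\<integral>\<^sup>+ x. ennreal (max_exponential_density n l x) * indicator {..a} x \<partial>lborel)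
    = ennreal (if a < 0 then 0 else (1 - exp (- l * a)) ^ n)"
proof (cases "a < 0")
  case True
  have "(\<integral>\<^sup>+ x. ennreal (max_exponential_density n l x) * indicator {..a} x \<partial>lborel)
      = (\<integral>\<^sup>+ x. 0 \<partial>(lborel :: real measure))"
    using True by (intro nn_integral_cong)
      (auto simp: max_exponential_density_eq split: split_indicator)
  then show ?thesis using True by simp
next
  case False
  let ?f = "\<lambda>x. real n * l * exp (- l * x) * (1 - exp (- l * x)) ^ (n - 1)"
  have "(\<integral>\<^sup>+ x. ennreal (max_exponential_density n l x) * indicator {..a} x \<partial>lborel)
      = (\<integral>\<^sup>+ x. ennreal (?f x) * indicator {0..a} x \<partial>lborel)"
    by (intro nn_integral_cong) (auto simp: max_exponential_density_eq split: split_indicator)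
  also have "\<dots> = ennreal ((1 - exp (- l * a)) ^ n - (1 - exp (- l * 0)) ^ n)"
  proof (rule nn_integral_FTC_Icc)
    show "((\<lambda>x. (1 - exp (- l * x)) ^ n) has_real_derivative ?f x) (at x)" for x
      by (auto intro!: derivative_eq_intros)
  qed (use False assms in auto)
  finally show ?thesis using False assms(2) by (simp add: power_0_left)
qed

lemma integral_max_exponential_density:
  assumes "0 < l" "n \<noteq> 0"
  shows "(\<integral>x. max_exponential_density n l x \<partial>lborel) = 1"
proof -
  let ?f = "\<lambda>x. real n * l * exp (- l * x) * (1 - exp (- l * x)) ^ (n - 1)"
  have "(\<integral>\<^sup>+ x. ennreal (max_exponential_density n l x) \<partial>lborel)
      = (\<integral>\<^sup>+ x. ennreal (?f x) * indicator {0..} x \<partial>lborel)"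
    by (intro nn_integral_cong) (auto simp: max_exponential_density_eq split: split_indicator)
  also have "\<dots> = ennreal (1 - (1 - exp (- l * 0)) ^ n)"
  proof (rule nn_integral_FTC_atLeast)
    show "((\<lambda>x. (1 - exp (- l * x)) ^ n) has_real_derivative ?f x) (at x)" for x
      by (auto intro!: derivative_eq_intros)
    show "((\<lambda>x. (1 - exp (- l * x)) ^ n) \<longlongrightarrow> 1) at_top"
      using assms(1) by real_asymp
  qed (use assms in auto)
  finally have "(\<integral>\<^sup>+ x. ennreal (max_exponential_density n l x) \<partial>lborel) = ennreal 1"
    using assms by simp
  then show ?thesis
    using max_exponential_density_nonneg[OF assms(1)]
    by (subst integral_eq_nn_integral) auto
qed

section \<open>Moments of the maximum\<close>

text \<open>
  The integration by parts: the function \<open>- x^(k + 1) exp (-l x) (1 - exp (-l x))^n\<close> vanishes at \<open>0\<close>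
  and at infinity, and its derivative is the difference of the two sides under the integral.
\<close>
lemma max_exponential_density_moment_Suc:
  assumes "0 < l"
  shows "(\<integral>x. max_exponential_density (Suc n) l x * x ^ Suc k \<partial>lborel)
    = (\<integral>x. max_exponential_density n l x * x ^ Suc k \<partial>lborel)
      + real (Suc k) / (real (Suc n) * l)
        * (\<integral>x. max_exponential_density (Suc n) l x * x ^ k \<partial>lborel)"
proof -
  define c where "c = real (Suc k) / (real (Suc n) * l)"
  let ?D = "\<lambda>x. max_exponential_density (Suc n) l x * x ^ Suc k
    - max_exponential_density n l x * x ^ Suc k
    - c * (max_exponential_density (Suc n) l x * x ^ k)"
  let ?q = "\<lambda>x. 1 - exp (- l * x)"
  let ?f = "\<lambda>x. real (Suc n) * l * exp (- l * x) * ?q x ^ n * x ^ Suc k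
    - real n * l * exp (- l * x) * ?q x ^ (n - 1) * x ^ Suc k
    - c * (real (Suc n) * l * exp (- l * x) * ?q x ^ n * x ^ k)"
  let ?F = "\<lambda>x. - (x ^ Suc k * exp (- l * x) * ?q x ^ n)"
  note int = integrable_max_exponential_density_moment[OF assms]
  have intD: "integrable lborel ?D"
    by (intro Bochner_Integration.integrable_diff integrable_mult_right int)
  \<comment> \<open>On the open positive half-line the integrand agrees with the function ?f, which is
    continuous on the whole line; on the negative half-line only the former vanishes.\<close>
  have eq: "indicator {0<..} x *\<^sub>R ?D x = indicator {0<..} x *\<^sub>R ?f x" for x
    by (auto simp: max_exponential_density_eq split: split_indicator)
  have deriv: "(?F has_real_derivative ?f x) (at x)" for x
  proof -
    have 1: "(?F has_real_derivative
        (- (real (Suc k) * x ^ k * exp (- l * x) * ?q x ^ n)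
         + l * x ^ Suc k * exp (- l * x) * ?q x ^ n
         - x ^ Suc k * exp (- l * x) * (real n * l * exp (- l * x) * ?q x ^ (n - 1)))) (at x)"
      by (auto intro!: derivative_eq_intros simp del: power_Suc simp: algebra_simps)
    have c: "c * (real (Suc n) * l) = real (Suc k)"
      using assms by (simp add: c_def)
    have c': "c * (real (Suc n) * l * exp (- l * x) * ?q x ^ n * x ^ k)
        = real (Suc k) * exp (- l * x) * ?q x ^ n * x ^ k"
      unfolding c[symmetric] by (simp only: mult_ac)
    \<comment> \<open>The factor n covers the case n = 0, in which n - 1 is 0.\<close>
    have q: "real n * ?q x ^ n = real n * (1 - exp (- l * x)) * ?q x ^ (n - 1)"
      by (cases n) auto
    have "?f x = - (real (Suc k) * x ^ k * exp (- l * x) * ?q x ^ n)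
         + l * x ^ Suc k * exp (- l * x) * ?q x ^ n
         + l * x ^ Suc k * exp (- l * x) * (real n * ?q x ^ n)
         - real n * l * exp (- l * x) * ?q x ^ (n - 1) * x ^ Suc k"
      unfolding c' by (simp add: algebra_simps)
    also have "\<dots> = - (real (Suc k) * x ^ k * exp (- l * x) * ?q x ^ n)
         + l * x ^ Suc k * exp (- l * x) * ?q x ^ n
         - x ^ Suc k * exp (- l * x) * (real n * l * exp (- l * x) * ?q x ^ (n - 1))"
      unfolding q by (simp add: algebra_simps)
    finally show ?thesis using 1 by simp
  qed
  have "(\<integral>x. ?D x \<partial>lborel) = (\<integral>x. indicator {0<..} x *\<^sub>R ?D x \<partial>lborel)"
  proof (rule integral_cong_AE)
    have "AE x in lborel. x \<noteq> (0::real)" by (rule AE_lborel_singleton)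
    then show "AE x in lborel. ?D x = indicator {0<..} x *\<^sub>R ?D x"
      by eventually_elim (auto simp: max_exponential_density_eq split: split_indicator)
  qed measurable
  also have "\<dots> = (LBINT x=ereal 0..\<infinity>. ?f x)"
    unfolding eq interval_integral_to_infinity_eq set_lebesgue_integral_def ..
  also have "\<dots> = 0 - 0"
  proof (rule interval_integral_FTC_integrable)
    show "(?F has_vector_derivative ?f x) (at x)" for x
      using deriv by (simp add: has_real_derivative_iff_has_vector_derivative)
    show "isCont ?f x" for x
      by (intro continuous_intros)
    show "set_integrable lborel (einterval (ereal 0) \<infinity>) ?f"
      unfolding set_integrable_def einterval_eq eq[symmetric]
      using integrable_mult_indicator[OF _ intD, of "{0<..}"] by simp
    have "(?F \<longlongrightarrow> ?F 0) (at_right 0)"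
      by (intro tendsto_intros)
    then show "((?F \<circ> real_of_ereal) \<longlongrightarrow> 0) (at_right (ereal 0))"
      unfolding zero_ereal_def[symmetric]
      by (simp add: ereal_tendsto_simps zero_ereal_def)
    have "(?F \<longlongrightarrow> 0) at_top"
      using assms by real_asymp
    then show "((?F \<circ> real_of_ereal) \<longlongrightarrow> 0) (at_left \<infinity>)"
      by (simp add: ereal_tendsto_simps)
  qed simp
  finally have "(\<integral>x. ?D x \<partial>lborel) = 0" by simp
  moreover have "(\<integral>x. ?D x \<partial>lborel) = (\<integral>x. max_exponential_density (Suc n) l x * x ^ Suc k \<partial>lborel)
      - (\<integral>x. max_exponential_density n l x * x ^ Suc k \<partial>lborel)
      - c * (\<integral>x. max_exponential_density (Suc n) l x * x ^ k \<partial>lborel)"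
    using int[of "Suc n" "Suc k"] int[of n "Suc k"] int[of "Suc n" k]
    by (simp del: power_Suc)
  ultimately show ?thesis by (simp add: c_def)
qed

lemma max_exponential_density_mean:
  assumes "0 < l"
  shows "(\<integral>x. max_exponential_density n l x * x \<partial>lborel) = (\<Sum>j=1..n. 1 / real j) / l"
proof (induction n)
  case (Suc n)
  then show ?case
    using max_exponential_density_moment_Suc[OF assms, of n 0] assms
      integral_max_exponential_density[OF assms, of "Suc n"]
    by (simp add: add_divide_distrib)
qed simp

lemma max_exponential_density_second_moment:
  assumes "0 < l"
  shows "(\<integral>x. max_exponential_density n l x * x\<^sup>2 \<partial>lborel)
    = ((\<Sum>j=1..n. 1 / (real j)\<^sup>2) + (\<Sum>j=1..n. 1 / real j)\<^sup>2) / l\<^sup>2"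
proof (induction n)
  case (Suc n)
  let ?h = "\<Sum>j=1..n. 1 / real j" and ?a = "1 / real (Suc n)"
  have "(\<integral>x. max_exponential_density (Suc n) l x * x\<^sup>2 \<partial>lborel)
      = ((\<Sum>j=1..n. 1 / (real j)\<^sup>2) + ?h\<^sup>2) / l\<^sup>2 + 2 * ?a / l * ((?h + ?a) / l)"
    using max_exponential_density_moment_Suc[OF assms, of n 1]
      max_exponential_density_mean[OF assms, of "Suc n"] Suc.IH
    by (simp add: power2_eq_square)
  \<comment> \<open>Completing the square: 2 a (h + a) = a^2 + (h + a)^2 - h^2.\<close>
  also have "\<dots> = (((\<Sum>j=1..n. 1 / (real j)\<^sup>2) + ?a\<^sup>2) + (?h + ?a)\<^sup>2) / l\<^sup>2"
    using assms by (simp add: power2_eq_square add_divide_distrib algebra_simps)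
  finally show ?case by (simp add: power_divide)
qed simp

section \<open>Mean and variance of the largest order statistic\<close>

lemma (in prob_space) max_exponential_distributed:
  assumes l: "0 < l" and n: "n \<noteq> 0"
    and indep: "indep_vars (\<lambda>_. borel) X {1..n}"
    and distr: "\<And>i. i \<in> {1..n} \<Longrightarrow> distributed M lborel (X i) (exponential_density l)"
  shows "distributed M lborel (largest_order_statistic n X) (max_exponential_density n l)"
proof (rule distributedI_borel_atMost)
  have meas: "X i \<in> borel_measurable M" if "i \<in> {1..n}" for i
    using distributed_measurable[OF distr[OF that]] by simp
  show "largest_order_statistic n X \<in> borel_measurable M"
    unfolding largest_order_statistic_def[abs_def] using meas n
    by (intro borel_measurable_Max) auto
  fix a :: real
  have "{x \<in> space M. largest_order_statistic n X x \<le> a}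
      = (\<Inter>i\<in>{1..n}. X i -` {..a} \<inter> space M)"
    using n by (auto simp: largest_order_statistic_def)
  moreover have "prob (\<Inter>i\<in>{1..n}. X i -` {..a} \<inter> space M)
      = (\<Prod>i\<in>{1..n}. prob (X i -` {..a} \<inter> space M))"
    using n by (intro indep_varsD[OF indep]) auto
  moreover have "prob (X i -` {..a} \<inter> space M) = (if a < 0 then 0 else 1 - exp (- l * a))"
    if "i \<in> {1..n}" for i
  proof -
    have "X i -` {..a} \<inter> space M = {x \<in> space M. X i x \<le> a}" by auto
    moreover have "prob {x \<in> space M. X i x \<le> a} = 0" if "a < 0"
    proof -
      have "prob {x \<in> space M. X i x \<le> a} \<le> prob {x \<in> space M. X i x \<le> 0}"
        using that meas[OF \<open>i \<in> {1..n}\<close>] by (intro finite_measure_mono) auto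
      also have "\<dots> = 0"
        using exponential_distributedD_le[OF distr[OF \<open>i \<in> {1..n}\<close>] _ l, of 0] by simp
      finally show ?thesis by (simp add: measure_le_0_iff)
    qed
    ultimately show ?thesis
      using exponential_distributedD_le[OF distr[OF that] _ l, of a] by (simp add: mult.commute)
  qed
  ultimately have "prob {x \<in> space M. largest_order_statistic n X x \<le> a}
      = (if a < 0 then 0 else (1 - exp (- l * a)) ^ n)"
    using n by simp
  then show "emeasure M {x \<in> space M. largest_order_statistic n X x \<le> a}
      = ennreal (if a < 0 then 0 else (1 - exp (- l * a)) ^ n)"
    by (simp add: emeasure_eq_measure)
  show "(\<integral>\<^sup>+ x. ennreal (max_exponential_density n l x * indicator {..a} x) \<partial>lborel)
      = ennreal (if a < 0 then 0 else (1 - exp (- l * a)) ^ n)"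
    unfolding nn_integral_max_exponential_density_atMost[OF l n, symmetric]
    by (intro nn_integral_cong) (auto split: split_indicator)
qed (use l in \<open>auto simp: max_exponential_density_nonneg\<close>)

lemma (in prob_space)
  assumes l: "0 < l" and n: "n \<noteq> 0"
    and indep: "indep_vars (\<lambda>_. borel) X {1..n}"
    and distr: "\<And>i. i \<in> {1..n} \<Longrightarrow> distributed M lborel (X i) (exponential_density l)"
  shows expectation_max_exponential:
      "expectation (largest_order_statistic n X) = (\<Sum>j=1..n. 1 / real j) / l"
    and variance_max_exponential:
      "variance (largest_order_statistic n X) = (\<Sum>j=1..n. 1 / (real j)\<^sup>2) / l\<^sup>2"
proof -
  let ?Y = "largest_order_statistic n X"
  note D = max_exponential_distributed[OF assms]
  note nonneg = max_exponential_density_nonneg[OF l]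
  have int: "integrable M (\<lambda>x. ?Y x ^ k)" for k
    using distributed_integrable[OF D, of "\<lambda>x. x ^ k"] nonneg
      integrable_max_exponential_density_moment[OF l] by simp
  have moment: "expectation (\<lambda>x. ?Y x ^ k) = (\<integral>x. max_exponential_density n l x * x ^ k \<partial>lborel)" for k
    using distributed_integral[OF D, of "\<lambda>x. x ^ k"] nonneg by simp
  show mean: "expectation ?Y = (\<Sum>j=1..n. 1 / real j) / l"
    using moment[of 1] max_exponential_density_mean[OF l, of n] by simp
  show "variance ?Y = (\<Sum>j=1..n. 1 / (real j)\<^sup>2) / l\<^sup>2"
    using int[of 1] int[of 2]
    by (subst variance_eq)
       (simp_all add: mean moment max_exponential_density_second_moment[OF l] add_divide_distrib power_divide)
qed

text \<open>
  The argument \<open>real n - real j + 1\<close> runs through \<open>n, \<dots>, 1\<close> as \<open>j\<close> runs through \<open>1, \<dots>, n\<close>.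
\<close>
lemma sum_reverse_index:
  fixes f :: "real \<Rightarrow> real"
  shows "(\<Sum>j=1..n. f (real n - real j + 1)) = (\<Sum>j=1..n. f (real j))"
  by (rule sum.reindex_bij_witness[of _ "\<lambda>j. Suc n - j" "\<lambda>j. Suc n - j"])
     (auto simp: of_nat_diff algebra_simps)

section \<open>Asymptotics of the harmonic sums\<close>

lemma harm_asymp_equiv:
  "(\<lambda>n. \<Sum>j=1..n. 1 / real j) \<sim>[sequentially] (\<lambda>n. euler_mascheroni + ln (real n))"
proof (rule smallo_imp_asymp_equiv)
  have "(\<lambda>n. harm n - ln (real n) - euler_mascheroni) \<longlonglongrightarrow> euler_mascheroni - (euler_mascheroni :: real)"
    by (intro tendsto_intros euler_mascheroni_LIMSEQ)
  then have "(\<lambda>n. harm n - ln (real n) - euler_mascheroni) \<in> o(\<lambda>_. 1 :: real)"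
    by (intro smalloI_tendsto) auto
  also have "(\<lambda>_. 1) \<in> O(\<lambda>n. euler_mascheroni + ln (real n))"
    by real_asymp
  finally show "(\<lambda>n. (\<Sum>j=1..n. 1 / real j) - (euler_mascheroni + ln (real n)))
      \<in> o(\<lambda>n. euler_mascheroni + ln (real n))"
    by (simp add: harm_def divide_inverse algebra_simps)
qed

lemma zeta_2: "zeta 2 = pi\<^sup>2 / 6"
proof -
  have "(\<lambda>k. 1 / real (Suc k) powr 2) = (\<lambda>n. 1 / (real n + 1)\<^sup>2)"
    by (auto simp: powr_numeral add_ac)
  then show ?thesis
    using sums_unique[OF inverse_squares_sums] by (simp add: zeta_def)
qed

lemma sum_inverse_squares_LIMSEQ: "(\<lambda>n. \<Sum>j=1..n. 1 / (real j)\<^sup>2) \<longlonglongrightarrow> pi\<^sup>2 / 6"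
proof -
  have "(\<Sum>j=1..n. 1 / (real j)\<^sup>2) = (\<Sum>k<n. 1 / (real k + 1)\<^sup>2)" for n
    by (rule sum.reindex_bij_witness[of _ Suc "\<lambda>j. j - 1"]) (auto simp: of_nat_diff)
  then show ?thesis
    using inverse_squares_sums by (simp add: sums_def add.commute)
qed

section \<open>Taylor's law for the maximum of the sample\<close>

theorem theorem5:
  fixes M :: "nat \<Rightarrow> 'a measure"
    and X :: "nat \<Rightarrow> nat \<Rightarrow> 'a \<Rightarrow> real"
    and E V :: "nat \<Rightarrow> real"
  defines "E \<equiv> \<lambda>n. prob_space.expectation (M n) (largest_order_statistic n (X n))"
    and "V \<equiv> \<lambda>n. prob_space.variance (M n) (largest_order_statistic n (X n))"
  assumes prob: "\<And>n. n > 1 \<Longrightarrow> prob_space (M n)"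
    and indep: "\<And>n. n > 1 \<Longrightarrow> prob_space.indep_vars (M n) (\<lambda>_. borel) (X n) {1..n}"
    and distr: "\<And>n i. n > 1 \<Longrightarrow> i \<in> {1..n} \<Longrightarrow>
      distributed (M n) lborel (X n i) (exponential_density (1 / ln (real n)))"
  shows "(\<forall>n>1. E n = ln (real n) * (\<Sum>j=1..n. 1 / (real n - real j + 1)))
    \<and> E \<sim>[sequentially] (\<lambda>n. ln (real n) * (euler_mascheroni + ln (real n)))
    \<and> (\<lambda>n. ln (real n) * (euler_mascheroni + ln (real n))) \<sim>[sequentially] (\<lambda>n. (ln (real n))\<^sup>2)
    \<and> (\<forall>n>1. V n = (ln (real n))\<^sup>2 * (\<Sum>j=1..n. 1 / (real n - real j + 1)\<^sup>2))
    \<and> V \<sim>[sequentially] (\<lambda>n. (ln (real n))\<^sup>2 * zeta 2)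
    \<and> (\<forall>n>1. (ln (real n))\<^sup>2 * zeta 2 = (ln (real n))\<^sup>2 * (pi\<^sup>2 / 6))
    \<and> (\<lambda>n. V n / E n) \<longlonglongrightarrow> pi\<^sup>2 / 6
    \<and> pi\<^sup>2 / 6 > 1
    \<and> V \<sim>[sequentially] (\<lambda>n. (pi\<^sup>2 / 6) * E n)
    \<and> taylors_law V E (pi\<^sup>2 / 6) 1"
proof -
  let ?H = "\<lambda>n. \<Sum>j=1..n. 1 / real j" and ?S = "\<lambda>n. \<Sum>j=1..n. 1 / (real j)\<^sup>2"
  let ?G = "\<lambda>n. ln (real n) * (euler_mascheroni + ln (real n))"
  have E: "E n = ln (real n) * ?H n" and V: "V n = (ln (real n))\<^sup>2 * ?S n" if "n > 1" for n
  proof -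
    interpret prob_space "M n" by (rule prob[OF that])
    have l: "0 < 1 / ln (real n)" using that by simp
    have n: "n \<noteq> 0" using that by simp
    show "E n = ln (real n) * ?H n"
      using expectation_max_exponential[OF l n indep[OF that] distr[OF that]]
      by (simp add: E_def mult.commute)
    show "V n = (ln (real n))\<^sup>2 * ?S n"
      using variance_max_exponential[OF l n indep[OF that] distr[OF that]]
      by (simp add: V_def power_divide mult.commute)
  qed
  have ev: "\<forall>\<^sub>F n in sequentially. n > (1::nat)"
    by (rule eventually_gt_at_top)
  have "(\<lambda>n. ln (real n) * ?H n) \<sim>[sequentially] ?G"
    by (intro asymp_equiv_intros harm_asymp_equiv)
  then have E_G: "E \<sim>[sequentially] ?G"
    by (rule asymp_equiv_transfer) (use eventually_mono[OF ev E[symmetric]] in simp_all)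
  have G: "?G \<sim>[sequentially] (\<lambda>n. (ln (real n))\<^sup>2)"
    by real_asymp
  have E_ln: "E \<sim>[sequentially] (\<lambda>n. (ln (real n))\<^sup>2)"
    by (rule asymp_equiv_trans[OF E_G G])
  have "?S \<sim>[sequentially] (\<lambda>_. pi\<^sup>2 / 6)"
    by (rule tendsto_imp_asymp_equiv_const[OF sum_inverse_squares_LIMSEQ]) simp
  then have "(\<lambda>n. (ln (real n))\<^sup>2 * ?S n) \<sim>[sequentially] (\<lambda>n. (ln (real n))\<^sup>2 * (pi\<^sup>2 / 6))"
    by (intro asymp_equiv_intros)
  then have V_ln: "V \<sim>[sequentially] (\<lambda>n. (ln (real n))\<^sup>2 * (pi\<^sup>2 / 6))"
    by (rule asymp_equiv_transfer) (use eventually_mono[OF ev V[symmetric]] in simp_all)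
  have E_pos: "E n > 0" if "n > 1" for n
    unfolding E[OF that] using that by (intro mult_pos_pos sum_pos) auto
  have "(\<lambda>n. (ln (real n))\<^sup>2 * (pi\<^sup>2 / 6)) \<sim>[sequentially] (\<lambda>n. E n * (pi\<^sup>2 / 6))"
    using E_ln by (intro asymp_equiv_intros) (simp add: asymp_equiv_sym)
  with V_ln have V_E: "V \<sim>[sequentially] (\<lambda>n. (pi\<^sup>2 / 6) * E n)"
    unfolding mult.commute[of _ "pi\<^sup>2 / 6"] by (rule asymp_equiv_trans)
  have "(\<lambda>n. V n / E n) \<sim>[sequentially] (\<lambda>n. (pi\<^sup>2 / 6) * E n / E n)"
    by (intro asymp_equiv_intros V_E)
  then have "(\<lambda>n. V n / E n) \<sim>[sequentially] (\<lambda>_. pi\<^sup>2 / 6)"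
  proof (rule asymp_equiv_transfer)
    show "\<forall>\<^sub>F n in sequentially. pi\<^sup>2 / 6 * E n / E n = pi\<^sup>2 / 6"
      using ev by eventually_elim (use E_pos in fastforce)
  qed simp
  then have ratio: "(\<lambda>n. V n / E n) \<longlonglongrightarrow> pi\<^sup>2 / 6"
    by (rule asymp_equivD_const)
  have "3\<^sup>2 < pi\<^sup>2"
    using pi_gt3 by (intro power_strict_mono) auto
  then have pi: "pi\<^sup>2 / 6 > 1" by simp
  have taylor: "taylors_law V E (pi\<^sup>2 / 6) 1"
    unfolding taylors_law_def using V_E
  proof (rule asymp_equiv_transfer)
    show "\<forall>\<^sub>F n in sequentially. pi\<^sup>2 / 6 * E n = pi\<^sup>2 / 6 * E n powr 1"
      using ev by eventually_elim (simp add: E_pos less_imp_le)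
  qed simp
  have E': "\<forall>n>1. E n = ln (real n) * (\<Sum>j=1..n. 1 / (real n - real j + 1))"
    unfolding sum_reverse_index[where f = "\<lambda>x. 1 / x"] using E by blast
  have V': "\<forall>n>1. V n = (ln (real n))\<^sup>2 * (\<Sum>j=1..n. 1 / (real n - real j + 1)\<^sup>2)"
    unfolding sum_reverse_index[where f = "\<lambda>x. 1 / x\<^sup>2"] using V by blast
  show ?thesis
    unfolding zeta_2 by (intro conjI E' V' E_G G V_ln V_E ratio pi taylor) simp
qed

end
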